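(* $\mathrm{DL}(1,\infty)$ implies $\mathrm{LPO}$ (constructively, i.e. in BISH).
   Context: The paper works constructively, in Bishop's informal constructive mathematics (BISH, with the principle of dependent choices); implications are to be proved without the principle of excluded middle. $\mathrm{DL}(1,\infty)$ is the statement: for every $\alpha:\mathbb{N}\to\mathbb{N}$ there is an infinite set of indices $\{i_1<i_2<i_3<\cdots\}\subseteq\mathbb{N}$ (given as a strictly increasing sequence) such that $\alpha(i)\le\alpha(j)$ for all $i<j$ in this set, i.e. $\alpha(i_1)\le\alpha(i_2)\le\alpha(i_3)\le\cdots$. $\mathrm{LPO}$ (limited principle of omniscience) is the statement: for every $\alpha:\mathbb{N}\to\{0,1\}$, either there exists $n\in\mathbb{N}$ with $\alpha(n)=1$, or $\alpha(n)=0$ for all $n\in\mathbb{N}$. *)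

theory Defs
  imports Main
begin

text \<open>
  HOL is classical, so an implication between the truth values of \<open>DL(1,\<infinity>)\<close> and \<open>LPO\<close>
  would be vacuous.  The claim is instead that the implication is derivable in a formal
  system for Bishop-style mathematics: intuitionistic arithmetic in all finite types with
  extensional equality (the system known as E-HA\<open>\<^sup>\<omega>\<close>, over the simply typed lambda
  calculus with primitive recursion), extended by dependent choice.
  Bound variables are de Bruijn indices, index \<open>0\<close> being the innermost binder.
\<close>

datatype ty = N | Fn ty ty  (infixr "\<^bold>\<Rightarrow>" 65)

datatype tm =
    Var nat
  | Lam ty tm
  | App tm tm  (infixl "\<^bold>\<cdot>" 80)
  | Zero
  | Succ
  | Rec ty

datatype fm =
    Falsum
  | Eq ty tm tm
  | Conj fm fm  (infixr "\<^bold>\<and>" 45)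
  | Disj fm fm  (infixr "\<^bold>\<or>" 44)
  | Imp fm fm  (infixr "\<^bold>\<longrightarrow>" 43)
  | Forall ty fm
  | Exists ty fm

inductive typed :: "ty list \<Rightarrow> tm \<Rightarrow> ty \<Rightarrow> bool" where
  Var: "i < length \<Gamma> \<Longrightarrow> typed \<Gamma> (Var i) (\<Gamma> ! i)"
| Lam: "typed (\<sigma> # \<Gamma>) t \<tau> \<Longrightarrow> typed \<Gamma> (Lam \<sigma> t) (\<sigma> \<^bold>\<Rightarrow> \<tau>)"
| App: "typed \<Gamma> s (\<sigma> \<^bold>\<Rightarrow> \<tau>) \<Longrightarrow> typed \<Gamma> t \<sigma> \<Longrightarrow> typed \<Gamma> (s \<^bold>\<cdot> t) \<tau>"
| Zero: "typed \<Gamma> Zero N"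
| Succ: "typed \<Gamma> Succ (N \<^bold>\<Rightarrow> N)"
| Rec: "typed \<Gamma> (Rec \<sigma>) (\<sigma> \<^bold>\<Rightarrow> (N \<^bold>\<Rightarrow> \<sigma> \<^bold>\<Rightarrow> \<sigma>) \<^bold>\<Rightarrow> N \<^bold>\<Rightarrow> \<sigma>)"

primrec wf_fm :: "ty list \<Rightarrow> fm \<Rightarrow> bool" where
  "wf_fm \<Gamma> Falsum \<longleftrightarrow> True"
| "wf_fm \<Gamma> (Eq \<tau> s t) \<longleftrightarrow> typed \<Gamma> s \<tau> \<and> typed \<Gamma> t \<tau>"
| "wf_fm \<Gamma> (\<phi> \<^bold>\<and> \<psi>) \<longleftrightarrow> wf_fm \<Gamma> \<phi> \<and> wf_fm \<Gamma> \<psi>"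
| "wf_fm \<Gamma> (\<phi> \<^bold>\<or> \<psi>) \<longleftrightarrow> wf_fm \<Gamma> \<phi> \<and> wf_fm \<Gamma> \<psi>"
| "wf_fm \<Gamma> (\<phi> \<^bold>\<longrightarrow> \<psi>) \<longleftrightarrow> wf_fm \<Gamma> \<phi> \<and> wf_fm \<Gamma> \<psi>"
| "wf_fm \<Gamma> (Forall \<tau> \<phi>) \<longleftrightarrow> wf_fm (\<tau> # \<Gamma>) \<phi>"
| "wf_fm \<Gamma> (Exists \<tau> \<phi>) \<longleftrightarrow> wf_fm (\<tau> # \<Gamma>) \<phi>"

text \<open>
  Parallel substitution.  \<open>scons t \<theta>\<close> sends index \<open>0\<close> to \<open>t\<close> and index \<open>i + 1\<close> to
  \<open>\<theta> i\<close>; \<open>ups \<theta>\<close> is \<open>\<theta>\<close> pushed under one binder.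
\<close>

primrec ren :: "(nat \<Rightarrow> nat) \<Rightarrow> tm \<Rightarrow> tm" where
  "ren r (Var i) = Var (r i)"
| "ren r (Lam \<tau> t) = Lam \<tau> (ren (case_nat 0 (\<lambda>i. Suc (r i))) t)"
| "ren r (s \<^bold>\<cdot> t) = ren r s \<^bold>\<cdot> ren r t"
| "ren r Zero = Zero"
| "ren r Succ = Succ"
| "ren r (Rec \<tau>) = Rec \<tau>"

definition scons :: "tm \<Rightarrow> (nat \<Rightarrow> tm) \<Rightarrow> nat \<Rightarrow> tm" where
  "scons t \<theta> = case_nat t \<theta>"

definition ups :: "(nat \<Rightarrow> tm) \<Rightarrow> nat \<Rightarrow> tm" where
  "ups \<theta> = scons (Var 0) (\<lambda>i. ren Suc (\<theta> i))"

primrec sub :: "(nat \<Rightarrow> tm) \<Rightarrow> tm \<Rightarrow> tm" where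
  "sub \<theta> (Var i) = \<theta> i"
| "sub \<theta> (Lam \<tau> t) = Lam \<tau> (sub (ups \<theta>) t)"
| "sub \<theta> (s \<^bold>\<cdot> t) = sub \<theta> s \<^bold>\<cdot> sub \<theta> t"
| "sub \<theta> Zero = Zero"
| "sub \<theta> Succ = Succ"
| "sub \<theta> (Rec \<tau>) = Rec \<tau>"

primrec subf :: "(nat \<Rightarrow> tm) \<Rightarrow> fm \<Rightarrow> fm" where
  "subf \<theta> Falsum = Falsum"
| "subf \<theta> (Eq \<tau> s t) = Eq \<tau> (sub \<theta> s) (sub \<theta> t)"
| "subf \<theta> (\<phi> \<^bold>\<and> \<psi>) = (subf \<theta> \<phi> \<^bold>\<and> subf \<theta> \<psi>)"
| "subf \<theta> (\<phi> \<^bold>\<or> \<psi>) = (subf \<theta> \<phi> \<^bold>\<or> subf \<theta> \<psi>)"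
| "subf \<theta> (\<phi> \<^bold>\<longrightarrow> \<psi>) = (subf \<theta> \<phi> \<^bold>\<longrightarrow> subf \<theta> \<psi>)"
| "subf \<theta> (Forall \<tau> \<phi>) = Forall \<tau> (subf (ups \<theta>) \<phi>)"
| "subf \<theta> (Exists \<tau> \<phi>) = Exists \<tau> (subf (ups \<theta>) \<phi>)"

abbreviation inst :: "fm \<Rightarrow> tm \<Rightarrow> fm" where
  "inst \<phi> t \<equiv> subf (scons t Var) \<phi>"

abbreviation lift :: "tm \<Rightarrow> tm" where
  "lift \<equiv> ren Suc"

abbreviation liftf :: "fm \<Rightarrow> fm" where
  "liftf \<equiv> subf (\<lambda>i. Var (Suc i))"

text \<open>
  \<open>bish \<Gamma> \<Delta> \<phi>\<close>: the formula \<open>\<phi>\<close> is derivable from the hypotheses \<open>\<Delta>\<close>, where the free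
  variable \<open>i\<close> has type \<open>\<Gamma> ! i\<close>.  The logical rules are those of intuitionistic natural
  deduction.

  Rule \<open>DC\<close> is dependent choice for the set \<open>X = {x : \<sigma>. P x}\<close>.  Bishop's sets include such
  subsets, and intuitionistically this form does not reduce to the one with \<open>X\<close> a full type.
  In \<open>P\<close> the variable \<open>0\<close> is \<open>x\<close>; in \<open>R\<close> the variables \<open>1\<close> and \<open>0\<close> are \<open>x\<close> and \<open>y\<close>.  The rule
  reads: if \<open>\<forall>x. P x \<longrightarrow> (\<exists>y. P y \<and> R x y)\<close> then
  \<open>\<forall>x\<^sub>0. P x\<^sub>0 \<longrightarrow> (\<exists>f. f 0 = x\<^sub>0 \<and> (\<forall>n. P (f n) \<and> R (f n) (f (n + 1))))\<close>.
\<close>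

inductive bish :: "ty list \<Rightarrow> fm list \<Rightarrow> fm \<Rightarrow> bool" where
  Assm: "\<phi> \<in> set \<Delta> \<Longrightarrow> wf_fm \<Gamma> \<phi> \<Longrightarrow> bish \<Gamma> \<Delta> \<phi>"
| FalsumE: "bish \<Gamma> \<Delta> Falsum \<Longrightarrow> wf_fm \<Gamma> \<phi> \<Longrightarrow> bish \<Gamma> \<Delta> \<phi>"
| ConjI: "bish \<Gamma> \<Delta> \<phi> \<Longrightarrow> bish \<Gamma> \<Delta> \<psi> \<Longrightarrow> bish \<Gamma> \<Delta> (\<phi> \<^bold>\<and> \<psi>)"
| ConjE1: "bish \<Gamma> \<Delta> (\<phi> \<^bold>\<and> \<psi>) \<Longrightarrow> bish \<Gamma> \<Delta> \<phi>"
| ConjE2: "bish \<Gamma> \<Delta> (\<phi> \<^bold>\<and> \<psi>) \<Longrightarrow> bish \<Gamma> \<Delta> \<psi>"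
| DisjI1: "bish \<Gamma> \<Delta> \<phi> \<Longrightarrow> wf_fm \<Gamma> \<psi> \<Longrightarrow> bish \<Gamma> \<Delta> (\<phi> \<^bold>\<or> \<psi>)"
| DisjI2: "bish \<Gamma> \<Delta> \<psi> \<Longrightarrow> wf_fm \<Gamma> \<phi> \<Longrightarrow> bish \<Gamma> \<Delta> (\<phi> \<^bold>\<or> \<psi>)"
| DisjE: "bish \<Gamma> \<Delta> (\<phi> \<^bold>\<or> \<psi>) \<Longrightarrow> bish \<Gamma> (\<phi> # \<Delta>) \<chi> \<Longrightarrow> bish \<Gamma> (\<psi> # \<Delta>) \<chi> \<Longrightarrow> bish \<Gamma> \<Delta> \<chi>"
| ImpI: "wf_fm \<Gamma> \<phi> \<Longrightarrow> bish \<Gamma> (\<phi> # \<Delta>) \<psi> \<Longrightarrow> bish \<Gamma> \<Delta> (\<phi> \<^bold>\<longrightarrow> \<psi>)"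
| ImpE: "bish \<Gamma> \<Delta> (\<phi> \<^bold>\<longrightarrow> \<psi>) \<Longrightarrow> bish \<Gamma> \<Delta> \<phi> \<Longrightarrow> bish \<Gamma> \<Delta> \<psi>"
| ForallI: "bish (\<tau> # \<Gamma>) (map liftf \<Delta>) \<phi> \<Longrightarrow> bish \<Gamma> \<Delta> (Forall \<tau> \<phi>)"
| ForallE: "bish \<Gamma> \<Delta> (Forall \<tau> \<phi>) \<Longrightarrow> typed \<Gamma> t \<tau> \<Longrightarrow> bish \<Gamma> \<Delta> (inst \<phi> t)"
| ExistsI: "wf_fm (\<tau> # \<Gamma>) \<phi> \<Longrightarrow> typed \<Gamma> t \<tau> \<Longrightarrow> bish \<Gamma> \<Delta> (inst \<phi> t) \<Longrightarrow>
    bish \<Gamma> \<Delta> (Exists \<tau> \<phi>)"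
| ExistsE: "bish \<Gamma> \<Delta> (Exists \<tau> \<phi>) \<Longrightarrow> wf_fm \<Gamma> \<psi> \<Longrightarrow>
    bish (\<tau> # \<Gamma>) (\<phi> # map liftf \<Delta>) (liftf \<psi>) \<Longrightarrow> bish \<Gamma> \<Delta> \<psi>"
| Refl: "typed \<Gamma> t \<tau> \<Longrightarrow> bish \<Gamma> \<Delta> (Eq \<tau> t t)"
| Replace: "wf_fm (\<tau> # \<Gamma>) \<phi> \<Longrightarrow> bish \<Gamma> \<Delta> (Eq \<tau> s t) \<Longrightarrow> bish \<Gamma> \<Delta> (inst \<phi> s) \<Longrightarrow>
    bish \<Gamma> \<Delta> (inst \<phi> t)"
| Beta: "typed (\<sigma> # \<Gamma>) t \<tau> \<Longrightarrow> typed \<Gamma> s \<sigma> \<Longrightarrow>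
    bish \<Gamma> \<Delta> (Eq \<tau> (Lam \<sigma> t \<^bold>\<cdot> s) (sub (scons s Var) t))"
| Ext: "typed \<Gamma> s (\<sigma> \<^bold>\<Rightarrow> \<tau>) \<Longrightarrow> typed \<Gamma> t (\<sigma> \<^bold>\<Rightarrow> \<tau>) \<Longrightarrow>
    bish \<Gamma> \<Delta> (Forall \<sigma> (Eq \<tau> (lift s \<^bold>\<cdot> Var 0) (lift t \<^bold>\<cdot> Var 0))) \<Longrightarrow>
    bish \<Gamma> \<Delta> (Eq (\<sigma> \<^bold>\<Rightarrow> \<tau>) s t)"
| RecZero: "typed \<Gamma> a \<sigma> \<Longrightarrow> typed \<Gamma> g (N \<^bold>\<Rightarrow> \<sigma> \<^bold>\<Rightarrow> \<sigma>) \<Longrightarrow>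
    bish \<Gamma> \<Delta> (Eq \<sigma> (Rec \<sigma> \<^bold>\<cdot> a \<^bold>\<cdot> g \<^bold>\<cdot> Zero) a)"
| RecSucc: "typed \<Gamma> a \<sigma> \<Longrightarrow> typed \<Gamma> g (N \<^bold>\<Rightarrow> \<sigma> \<^bold>\<Rightarrow> \<sigma>) \<Longrightarrow> typed \<Gamma> t N \<Longrightarrow>
    bish \<Gamma> \<Delta> (Eq \<sigma> (Rec \<sigma> \<^bold>\<cdot> a \<^bold>\<cdot> g \<^bold>\<cdot> (Succ \<^bold>\<cdot> t)) (g \<^bold>\<cdot> t \<^bold>\<cdot> (Rec \<sigma> \<^bold>\<cdot> a \<^bold>\<cdot> g \<^bold>\<cdot> t)))"
| SuccInj: "typed \<Gamma> s N \<Longrightarrow> typed \<Gamma> t N \<Longrightarrow> bish \<Gamma> \<Delta> (Eq N (Succ \<^bold>\<cdot> s) (Succ \<^bold>\<cdot> t)) \<Longrightarrow>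
    bish \<Gamma> \<Delta> (Eq N s t)"
| SuccZero: "bish \<Gamma> \<Delta> (Eq N (Succ \<^bold>\<cdot> t) Zero) \<Longrightarrow> bish \<Gamma> \<Delta> Falsum"
| Induct: "wf_fm (N # \<Gamma>) \<phi> \<Longrightarrow> bish \<Gamma> \<Delta> (inst \<phi> Zero) \<Longrightarrow>
    bish \<Gamma> \<Delta> (Forall N (\<phi> \<^bold>\<longrightarrow> subf (scons (Succ \<^bold>\<cdot> Var 0) (\<lambda>i. Var (i + 1))) \<phi>)) \<Longrightarrow>
    bish \<Gamma> \<Delta> (Forall N \<phi>)"
| DC: "wf_fm (\<sigma> # \<Gamma>) P \<Longrightarrow> wf_fm (\<sigma> # \<sigma> # \<Gamma>) R \<Longrightarrow>
    bish \<Gamma> \<Delta> (Forall \<sigma> (P \<^bold>\<longrightarrow> Exists \<sigma> (subf (scons (Var 0) (\<lambda>i. Var (i + 2))) P \<^bold>\<and> R))) \<Longrightarrow>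
    bish \<Gamma> \<Delta> (Forall \<sigma> (P \<^bold>\<longrightarrow> Exists (N \<^bold>\<Rightarrow> \<sigma>)
      (Eq \<sigma> (Var 0 \<^bold>\<cdot> Zero) (Var 1) \<^bold>\<and>
       Forall N (subf (scons (Var 1 \<^bold>\<cdot> Var 0) (\<lambda>i. Var (i + 3))) P \<^bold>\<and>
         subf (scons (Var 1 \<^bold>\<cdot> (Succ \<^bold>\<cdot> Var 0)) (scons (Var 1 \<^bold>\<cdot> Var 0) (\<lambda>i. Var (i + 3)))) R))))"

definition plus :: "tm \<Rightarrow> tm \<Rightarrow> tm" where
  "plus s t = Rec N \<^bold>\<cdot> s \<^bold>\<cdot> Lam N (Lam N (Succ \<^bold>\<cdot> Var 0)) \<^bold>\<cdot> t"

definition leq :: "tm \<Rightarrow> tm \<Rightarrow> fm" where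
  "leq s t = Exists N (Eq N (plus (lift s) (Var 0)) (lift t))"

definition lt :: "tm \<Rightarrow> tm \<Rightarrow> fm" where
  "lt s t = leq (Succ \<^bold>\<cdot> s) t"

text \<open>
  The infinite set is \<open>{f 0 < f 1 < \<dots>}\<close>.  Below both quantified number variables the
  indices \<open>3, 2, 1, 0\<close> stand for \<open>\<alpha>, f, m, n\<close>.
\<close>

definition DL_1_inf :: fm where
  "DL_1_inf =
     Forall (N \<^bold>\<Rightarrow> N) (Exists (N \<^bold>\<Rightarrow> N)
       (Forall N (Forall N
          (lt (Var 1) (Var 0) \<^bold>\<longrightarrow> lt (Var 2 \<^bold>\<cdot> Var 1) (Var 2 \<^bold>\<cdot> Var 0))) \<^bold>\<and>
        Forall N (Forall N
          (lt (Var 2 \<^bold>\<cdot> Var 1) (Var 2 \<^bold>\<cdot> Var 0) \<^bold>\<longrightarrow>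
           leq (Var 3 \<^bold>\<cdot> (Var 2 \<^bold>\<cdot> Var 1)) (Var 3 \<^bold>\<cdot> (Var 2 \<^bold>\<cdot> Var 0))))))"

text \<open>A map into \<open>{0, 1}\<close> is a map \<open>\<alpha> : N \<Rightarrow> N\<close> all of whose values are \<open>0\<close> or \<open>1\<close>.\<close>

definition LPO :: fm where
  "LPO =
     Forall (N \<^bold>\<Rightarrow> N)
       (Forall N (Eq N (Var 1 \<^bold>\<cdot> Var 0) Zero \<^bold>\<or> Eq N (Var 1 \<^bold>\<cdot> Var 0) (Succ \<^bold>\<cdot> Zero)) \<^bold>\<longrightarrow>
        Exists N (Eq N (Var 1 \<^bold>\<cdot> Var 0) (Succ \<^bold>\<cdot> Zero)) \<^bold>\<or>
        Forall N (Eq N (Var 1 \<^bold>\<cdot> Var 0) Zero))"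

end

theory Submission imports Defs begin

text \<open>
  Given a binary sequence \<open>a\<close>, let \<open>b n = 1\<close> as long as no \<open>1\<close> occurs among
  \<open>a 0, \<dots>, a (n - 1)\<close>, and \<open>b n = 0\<close> from then on.  \<open>DL(1,\<infinity>)\<close> yields an increasing \<open>f\<close>
  along which \<open>b\<close> does not decrease.  The single value \<open>b (f 0)\<close> then decides \<open>LPO\<close> for \<open>a\<close>:
  if it is \<open>0\<close>, a \<open>1\<close> has occurred before \<open>f 0\<close>; if it is \<open>1\<close>, then \<open>a\<close> is \<open>0\<close> everywhere.
  For if \<open>a n = 1\<close>, then \<open>b\<close> is \<open>0\<close> from \<open>n + 1\<close> on, so \<open>b (f (n + 1)) = 0\<close> because
  \<open>n + 1 \<le> f (n + 1)\<close>, although \<open>b (f 0) \<le> b (f (n + 1))\<close>.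

  As \<open>a\<close> is binary, every case distinction here is on a value of \<open>a\<close> or on a disjunction proved
  by induction, so the argument is intuitionistic.  The sequence \<open>b\<close> is the term \<open>flag a\<close>,
  primitive recursive in \<open>a\<close>.  The steps are \<open>has_one_or_flag\<close> (what a value of
  \<open>b\<close> tells about \<open>a\<close>), \<open>flag_vanishes_above\<close>, \<open>increasing_above_id\<close> and
  \<open>one_contradicts_flag\<close>; \<open>decide_along_subsequence\<close> assembles them.

  The lemmas are derived rules for arbitrary terms in arbitrary contexts \<open>\<Gamma>\<close>, \<open>\<Delta>\<close>.  Going under a
  quantifier replaces \<open>\<Delta>\<close> by \<open>map liftf \<Delta>\<close>, and a premise of the form \<open>bish \<Gamma> \<Delta> \<phi>\<close> does not
  move there unless \<open>bish\<close> is shown to be closed under weakening of \<open>\<Gamma>\<close>, whereas \<open>\<phi> \<in> set \<Delta>\<close> gives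
  \<open>liftf \<phi> \<in> set (map liftf \<Delta>)\<close> at once.  Hence a hypothesis that is needed under a
  quantifier is stated as membership in \<open>\<Delta>\<close>, or else the object-level implication from it is
  derived first and discharged by modus ponens.
\<close>

section \<open>Substitution\<close>

text \<open>
  Lifting is renaming by \<open>Suc\<close>, so all that the derived rules need is how a substitution passes
  a renaming.  The key consequences are that instantiating undoes lifting, and that a
  substitution under a binder commutes with it; as simplification rules they compute the
  instances of the formulas below, in which parameters always occur lifted.
\<close>

lemma scons_simps [simp]: "scons t \<theta> 0 = t" "scons t \<theta> (Suc i) = \<theta> i"
  by (simp_all add: scons_def)

lemma ups_simps [simp]: "ups \<theta> 0 = Var 0" "ups \<theta> (Suc i) = lift (\<theta> i)"
  by (simp_all add: ups_def)

lemma ren_ren: "ren r (ren q t) = ren (\<lambda>i. r (q i)) t"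
proof (induction t arbitrary: r q)
  case (Lam \<tau> t)
  have "(\<lambda>i. case_nat 0 (\<lambda>i. Suc (r i)) (case_nat 0 (\<lambda>i. Suc (q i)) i))
      = case_nat 0 (\<lambda>i. Suc (r (q i)))"
    by (rule ext) (simp split: nat.split)
  then show ?case by (simp add: Lam)
qed simp_all

lemma sub_ren: "sub \<theta> (ren r t) = sub (\<lambda>i. \<theta> (r i)) t"
proof (induction t arbitrary: \<theta> r)
  case (Lam \<tau> t)
  have "(\<lambda>i. ups \<theta> (case_nat 0 (\<lambda>i. Suc (r i)) i)) = ups (\<lambda>i. \<theta> (r i))"
    by (rule ext) (simp add: ups_def scons_def split: nat.split)
  then show ?case by (simp add: Lam)
qed simp_all

lemma ren_sub: "ren r (sub \<theta> t) = sub (\<lambda>i. ren r (\<theta> i)) t"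
proof (induction t arbitrary: \<theta> r)
  case (Lam \<tau> t)
  have "(\<lambda>i. ren (case_nat 0 (\<lambda>i. Suc (r i))) (ups \<theta> i)) = ups (\<lambda>i. ren r (\<theta> i))"
    by (rule ext) (simp add: ups_def scons_def ren_ren split: nat.split)
  then show ?case by (simp add: Lam)
qed simp_all

lemma sub_Var_ren: "sub (\<lambda>i. Var (r i)) t = ren r t"
proof (induction t arbitrary: r)
  case (Lam \<tau> t)
  have "ups (\<lambda>i. Var (r i)) = (\<lambda>i. Var (case_nat 0 (\<lambda>i. Suc (r i)) i))"
    by (rule ext) (simp add: ups_def scons_def split: nat.split)
  then show ?case by (simp add: Lam)
qed simp_all

lemma ren_id: "ren (\<lambda>i. i) t = t"
proof (induction t)
  case (Lam \<tau> t)
  have "case_nat 0 Suc = (\<lambda>i. i)" by (rule ext) (simp split: nat.split)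
  then show ?case by (simp add: Lam)
qed simp_all

lemma sub_id [simp]: "sub Var t = t"
  using sub_Var_ren[of "\<lambda>i. i" t] by (simp add: ren_id)

lemma sub_shift [simp]: "sub (\<lambda>i. Var (Suc i)) t = lift t"
  by (rule sub_Var_ren)

lemma sub_scons_lift [simp]: "sub (scons s \<theta>) (lift t) = sub \<theta> t"
  by (simp add: sub_ren)

lemma sub_ups_lift [simp]: "sub (ups \<theta>) (lift t) = lift (sub \<theta> t)"
  by (simp add: sub_ren ren_sub)

lemma sub_plus [simp]: "sub \<theta> (plus s t) = plus (sub \<theta> s) (sub \<theta> t)"
  by (simp add: plus_def)

lemma ren_plus [simp]: "ren r (plus s t) = plus (ren r s) (ren r t)"
  by (simp add: plus_def)

lemma subf_leq [simp]: "subf \<theta> (leq s t) = leq (sub \<theta> s) (sub \<theta> t)"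
  by (simp add: leq_def)

lemma subf_lt [simp]: "subf \<theta> (lt s t) = lt (sub \<theta> s) (sub \<theta> t)"
  by (simp add: lt_def)

section \<open>Typing\<close>

lemma typed_VarI: "i < length \<Gamma> \<Longrightarrow> \<Gamma> ! i = \<tau> \<Longrightarrow> typed \<Gamma> (Var i) \<tau>"
  using typed.Var by blast

lemma typed_Var_iff [simp]: "typed \<Gamma> (Var i) \<tau> \<longleftrightarrow> i < length \<Gamma> \<and> \<Gamma> ! i = \<tau>"
  by (auto intro: typed_VarI elim: typed.cases)

lemma typed_App_N [simp]:
  "typed \<Gamma> s (N \<^bold>\<Rightarrow> \<tau>) \<Longrightarrow> typed \<Gamma> t N \<Longrightarrow> typed \<Gamma> (s \<^bold>\<cdot> t) \<tau>"
  by (rule typed.App)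

lemma typed_ren:
  "typed \<Gamma> t \<tau> \<Longrightarrow> (\<And>i. i < length \<Gamma> \<Longrightarrow> r i < length \<Gamma>' \<and> \<Gamma>' ! r i = \<Gamma> ! i) \<Longrightarrow>
   typed \<Gamma>' (ren r t) \<tau>"
proof (induction arbitrary: r \<Gamma>' rule: typed.induct)
  case (Lam \<sigma> \<Gamma> t \<tau>)
  have "typed (\<sigma> # \<Gamma>') (ren (case_nat 0 (\<lambda>i. Suc (r i))) t) \<tau>"
    by (rule Lam.IH) (use Lam.prems in \<open>auto split: nat.split simp: less_Suc_eq_0_disj\<close>)
  then show ?case by (simp add: typed.Lam)
next
  case (App \<Gamma> s \<sigma> \<tau> t)
  then show ?case by (simp add: typed.App[of _ _ \<sigma>])
qed (auto intro: typed.Zero typed.Succ typed.Rec typed_VarI)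

lemma typed_lift [intro, simp]: "typed \<Gamma> t \<tau> \<Longrightarrow> typed (\<sigma> # \<Gamma>) (lift t) \<tau>"
  by (erule typed_ren) simp

definition typed_subst :: "ty list \<Rightarrow> (nat \<Rightarrow> tm) \<Rightarrow> ty list \<Rightarrow> bool" where
  "typed_subst \<Gamma>' \<theta> \<Gamma> \<longleftrightarrow> (\<forall>i < length \<Gamma>. typed \<Gamma>' (\<theta> i) (\<Gamma> ! i))"

lemma typed_subst_scons [intro]:
  "typed \<Gamma>' t \<tau> \<Longrightarrow> typed_subst \<Gamma>' \<theta> \<Gamma> \<Longrightarrow> typed_subst \<Gamma>' (scons t \<theta>) (\<tau> # \<Gamma>)"
  by (auto simp: typed_subst_def less_Suc_eq_0_disj)

lemma typed_subst_ups [intro]: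
  "typed_subst \<Gamma>' \<theta> \<Gamma> \<Longrightarrow> typed_subst (\<tau> # \<Gamma>') (ups \<theta>) (\<tau> # \<Gamma>)"
  by (auto simp: typed_subst_def less_Suc_eq_0_disj intro: typed_VarI)

lemma typed_subst_shift:
  "length \<Gamma>\<^sub>0 = n \<Longrightarrow> typed_subst (\<Gamma>\<^sub>0 @ \<Gamma>) (\<lambda>i. Var (i + n)) \<Gamma>"
  by (auto simp: typed_subst_def nth_append intro!: typed_VarI)

lemma typed_subst_Var [intro]: "typed_subst \<Gamma> Var \<Gamma>"
  by (auto simp: typed_subst_def intro: typed_VarI)

lemma typed_sub: "typed \<Gamma> t \<tau> \<Longrightarrow> typed_subst \<Gamma>' \<theta> \<Gamma> \<Longrightarrow> typed \<Gamma>' (sub \<theta> t) \<tau>"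
proof (induction arbitrary: \<theta> \<Gamma>' rule: typed.induct)
  case (Var i \<Gamma>)
  then show ?case by (simp add: typed_subst_def)
next
  case (Lam \<sigma> \<Gamma> t \<tau>)
  then show ?case by (auto intro: typed.Lam)
next
  case (App \<Gamma> s \<sigma> \<tau> t)
  then show ?case by (simp add: typed.App[of _ _ \<sigma>])
qed (auto intro: typed.Zero typed.Succ typed.Rec)

lemma wf_subf: "wf_fm \<Gamma> \<phi> \<Longrightarrow> typed_subst \<Gamma>' \<theta> \<Gamma> \<Longrightarrow> wf_fm \<Gamma>' (subf \<theta> \<phi>)"
  by (induction \<phi> arbitrary: \<theta> \<Gamma> \<Gamma>') (auto intro: typed_sub)

inductive_cases typed_LamE [elim!]: "typed \<Gamma> (Lam \<sigma> t) \<tau>"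
inductive_cases typed_AppE [elim!]: "typed \<Gamma> (s \<^bold>\<cdot> t) \<tau>"
inductive_cases typed_SuccE [elim!]: "typed \<Gamma> Succ \<tau>"
inductive_cases typed_RecE [elim!]: "typed \<Gamma> (Rec \<sigma>) \<tau>"

lemma typed_Succ_App [simp]: "typed \<Gamma> (Succ \<^bold>\<cdot> t) N \<longleftrightarrow> typed \<Gamma> t N"
  by (auto intro: typed.intros)

lemma typed_plus [intro, simp]: "typed \<Gamma> s N \<Longrightarrow> typed \<Gamma> t N \<Longrightarrow> typed \<Gamma> (plus s t) N"
  unfolding plus_def by (rule typed.intros | simp)+

declare typed.Zero [simp]

lemma wf_leq [intro, simp]: "typed \<Gamma> s N \<Longrightarrow> typed \<Gamma> t N \<Longrightarrow> wf_fm \<Gamma> (leq s t)"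
  by (simp add: leq_def)

lemma wf_lt [intro, simp]: "typed \<Gamma> s N \<Longrightarrow> typed \<Gamma> t N \<Longrightarrow> wf_fm \<Gamma> (lt s t)"
  by (simp add: lt_def)

text \<open>
  Typing facts can thus be read off from derivations, which is how the rules for equality and
  order below discharge the typing premises of the basic rules.
\<close>

lemma bish_wf: "bish \<Gamma> \<Delta> \<phi> \<Longrightarrow> wf_fm \<Gamma> \<phi>"
proof (induction rule: bish.induct)
  case (DC \<sigma> \<Gamma> P R \<Delta>)
  \<comment> \<open>The conclusion of dependent choice reads \<open>P\<close> and \<open>R\<close> below the binders \<open>x\<^sub>0\<close>, \<open>f\<close> and \<open>n\<close>.\<close>
  have shift: "typed_subst (N # (N \<^bold>\<Rightarrow> \<sigma>) # \<sigma> # \<Gamma>) (\<lambda>i. Var (i + 3)) \<Gamma>"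
    using typed_subst_shift[of "[N, N \<^bold>\<Rightarrow> \<sigma>, \<sigma>]" 3 \<Gamma>] by simp
  have f: "typed (N # (N \<^bold>\<Rightarrow> \<sigma>) # \<sigma> # \<Gamma>) (Var (Suc 0) \<^bold>\<cdot> t) \<sigma>"
    if "typed (N # (N \<^bold>\<Rightarrow> \<sigma>) # \<sigma> # \<Gamma>) t N" for t
    by (rule typed.App[OF typed_VarI that]) simp_all
  have f0: "typed ((N \<^bold>\<Rightarrow> \<sigma>) # \<sigma> # \<Gamma>) (Var 0 \<^bold>\<cdot> Zero) \<sigma>"
    by (rule typed.App[OF typed_VarI typed.Zero]) simp_all
  show ?case
    by (auto intro!: DC.hyps wf_subf[OF DC.hyps(1)] wf_subf[OF DC.hyps(2)] typed_subst_scons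
        shift f f0)
next
  case (Replace \<tau> \<Gamma> \<phi> \<Delta> s t)
  then show ?case by (auto intro: wf_subf)
next
  case (RecZero \<Gamma> a \<sigma> g \<Delta>)
  then show ?case by (auto intro!: typed.App[OF typed.App[OF typed.App[OF typed.Rec]]])
next
  case (RecSucc \<Gamma> a \<sigma> g t \<Delta>)
  have r: "typed \<Gamma> (Rec \<sigma> \<^bold>\<cdot> a \<^bold>\<cdot> g \<^bold>\<cdot> u) \<sigma>" if "typed \<Gamma> u N" for u
    by (intro typed.App[OF typed.App[OF typed.App[OF typed.Rec]]] RecSucc that)
  show ?case
    using RecSucc by (auto intro!: r typed.App[of _ "g \<^bold>\<cdot> t" \<sigma>] typed.App[of _ g N])
next
  case (Beta \<sigma> \<Gamma> t \<tau> s \<Delta>)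
  then show ?case by (auto intro!: typed.App[OF typed.Lam] typed_sub[OF Beta(1)])
qed (auto intro: wf_subf)

lemma Eq_typed:
  assumes "bish \<Gamma> \<Delta> (Eq \<tau> s t)" shows "typed \<Gamma> s \<tau>" "typed \<Gamma> t \<tau>"
  using bish_wf[OF assms] by simp_all

section \<open>Equality\<close>

text \<open>
  Symmetry, transitivity and congruence are all instances of replacement, with the replaced
  term as the variable \<open>0\<close> and the other terms lifted past it.
\<close>

lemma Eq_sym:
  assumes "bish \<Gamma> \<Delta> (Eq \<tau> s t)" shows "bish \<Gamma> \<Delta> (Eq \<tau> t s)"
  using bish.Replace[of \<tau> \<Gamma> "Eq \<tau> (Var 0) (lift s)" \<Delta> s t] assms Eq_typed[OF assms]
  by (auto intro: bish.Refl)

lemma Eq_trans [trans]: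
  assumes "bish \<Gamma> \<Delta> (Eq \<tau> s t)" "bish \<Gamma> \<Delta> (Eq \<tau> t u)" shows "bish \<Gamma> \<Delta> (Eq \<tau> s u)"
  using bish.Replace[of \<tau> \<Gamma> "Eq \<tau> (lift s) (Var 0)" \<Delta> t u] assms Eq_typed[OF assms(1)]
  by auto

lemma Eq_App:
  assumes st: "bish \<Gamma> \<Delta> (Eq (\<sigma> \<^bold>\<Rightarrow> \<tau>) s s')" and t: "bish \<Gamma> \<Delta> (Eq \<sigma> t t')"
  shows "bish \<Gamma> \<Delta> (Eq \<tau> (s \<^bold>\<cdot> t) (s' \<^bold>\<cdot> t'))"
proof -
  note ty = Eq_typed[OF st] Eq_typed[OF t]
  have "bish \<Gamma> \<Delta> (Eq \<tau> (s \<^bold>\<cdot> t) (s' \<^bold>\<cdot> t))"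
  proof -
    have "wf_fm ((\<sigma> \<^bold>\<Rightarrow> \<tau>) # \<Gamma>) (Eq \<tau> (lift (s \<^bold>\<cdot> t)) (Var 0 \<^bold>\<cdot> lift t))"
      using ty by (auto intro!: typed.App[of _ _ \<sigma>])
    from bish.Replace[OF this st] show ?thesis
      using ty by (simp add: bish.Refl typed.App[of _ _ \<sigma>])
  qed
  moreover have "bish \<Gamma> \<Delta> (Eq \<tau> (s' \<^bold>\<cdot> t) (s' \<^bold>\<cdot> t'))"
  proof -
    have "wf_fm (\<sigma> # \<Gamma>) (Eq \<tau> (lift (s' \<^bold>\<cdot> t)) (lift s' \<^bold>\<cdot> Var 0))"
      using ty by (auto intro!: typed.App[of _ _ \<sigma>])
    from bish.Replace[OF this t] show ?thesis
      using ty by (simp add: bish.Refl typed.App[of _ _ \<sigma>])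
  qed
  ultimately show ?thesis by (rule Eq_trans)
qed

lemma Eq_arg:
  "typed \<Gamma> s (\<sigma> \<^bold>\<Rightarrow> \<tau>) \<Longrightarrow> bish \<Gamma> \<Delta> (Eq \<sigma> t t') \<Longrightarrow> bish \<Gamma> \<Delta> (Eq \<tau> (s \<^bold>\<cdot> t) (s \<^bold>\<cdot> t'))"
  by (rule Eq_App[OF bish.Refl])

lemmas Eq_Succ = Eq_arg[OF typed.Succ]

lemma Beta2:
  assumes t: "typed (\<rho> # \<sigma> # \<Gamma>) t \<tau>" and s: "typed \<Gamma> s \<sigma>" and u: "typed \<Gamma> u \<rho>"
  shows "bish \<Gamma> \<Delta> (Eq \<tau> (Lam \<sigma> (Lam \<rho> t) \<^bold>\<cdot> s \<^bold>\<cdot> u) (sub (scons u Var) (sub (ups (scons s Var)) t)))"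
proof -
  have "bish \<Gamma> \<Delta> (Eq \<tau> (Lam \<sigma> (Lam \<rho> t) \<^bold>\<cdot> s \<^bold>\<cdot> u) (Lam \<rho> (sub (ups (scons s Var)) t) \<^bold>\<cdot> u))"
    using bish.Beta[OF typed.Lam[OF t] s, of \<Delta>] by (auto intro: Eq_App bish.Refl u)
  also have "bish \<Gamma> \<Delta> (Eq \<tau> (Lam \<rho> (sub (ups (scons s Var)) t) \<^bold>\<cdot> u)
      (sub (scons u Var) (sub (ups (scons s Var)) t)))"
    using s by (intro bish.Beta typed_sub[OF t] u) auto
  finally show ?thesis .
qed

section \<open>Addition and order\<close>

text \<open>
  Induction in the form used below: the formula is chosen with the induction variable at index
  \<open>0\<close> and all parameters lifted, so that the instance at \<open>t\<close> simplifies to the intended claim.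
\<close>

lemma Induct_inst:
  assumes "wf_fm (N # \<Gamma>) \<phi>" "bish \<Gamma> \<Delta> (inst \<phi> Zero)"
    and "bish (N # \<Gamma>) (\<phi> # map liftf \<Delta>) (subf (scons (Succ \<^bold>\<cdot> Var 0) (\<lambda>i. Var (Suc i))) \<phi>)"
    and "typed \<Gamma> t N"
  shows "bish \<Gamma> \<Delta> (inst \<phi> t)"
proof (rule bish.ForallE[OF bish.Induct])
  show "bish \<Gamma> \<Delta> (Forall N (\<phi> \<^bold>\<longrightarrow> subf (scons (Succ \<^bold>\<cdot> Var 0) (\<lambda>i. Var (i + 1))) \<phi>))"
    using assms(1,3) by (intro bish.ForallI bish.ImpI) simp_all
qed (use assms in simp_all)

lemma plus_cong:
  assumes "bish \<Gamma> \<Delta> (Eq N s s')" "bish \<Gamma> \<Delta> (Eq N t t')"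
  shows "bish \<Gamma> \<Delta> (Eq N (plus s t) (plus s' t'))"
proof -
  have "typed \<Gamma> (Lam N (Lam N (Succ \<^bold>\<cdot> Var 0))) (N \<^bold>\<Rightarrow> N \<^bold>\<Rightarrow> N)"
    by (intro typed.Lam) simp
  from bish.Refl[OF this] show ?thesis
    unfolding plus_def by (rule Eq_App[OF Eq_App[OF Eq_arg[OF typed.Rec assms(1)]] assms(2)])
qed

lemma plus_Zero: "typed \<Gamma> s N \<Longrightarrow> bish \<Gamma> \<Delta> (Eq N (plus s Zero) s)"
  unfolding plus_def by (rule bish.RecZero) (simp_all add: typed.Lam)

lemma plus_Succ:
  assumes s: "typed \<Gamma> s N" and t: "typed \<Gamma> t N"
  shows "bish \<Gamma> \<Delta> (Eq N (plus s (Succ \<^bold>\<cdot> t)) (Succ \<^bold>\<cdot> plus s t))"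
proof -
  let ?g = "Lam N (Lam N (Succ \<^bold>\<cdot> Var 0))"
  have g: "typed \<Gamma> ?g (N \<^bold>\<Rightarrow> N \<^bold>\<Rightarrow> N)"
    by (simp add: typed.Lam)
  have "bish \<Gamma> \<Delta> (Eq N (plus s (Succ \<^bold>\<cdot> t)) (?g \<^bold>\<cdot> t \<^bold>\<cdot> plus s t))"
    unfolding plus_def using s g t by (rule bish.RecSucc)
  also have "bish \<Gamma> \<Delta> (Eq N (?g \<^bold>\<cdot> t \<^bold>\<cdot> plus s t) (Succ \<^bold>\<cdot> plus s t))"
    using Beta2[of N N \<Gamma> "Succ \<^bold>\<cdot> Var 0" N t "plus s t" \<Delta>] s t by simp
  finally show ?thesis .
qed

text \<open>
  Addition recurses on its second argument, so the equations for the first argument need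
  induction.
\<close>

lemma Zero_plus:
  assumes "typed \<Gamma> t N" shows "bish \<Gamma> \<Delta> (Eq N (plus Zero t) t)"
proof -
  let ?\<phi> = "Eq N (plus Zero (Var 0)) (Var 0)"
  have "bish \<Gamma> \<Delta> (inst ?\<phi> t)"
  proof (rule Induct_inst[OF _ _ _ assms])
    have v: "typed (N # \<Gamma>) (Var 0) N" by simp
    let ?\<Delta> = "?\<phi> # map liftf \<Delta>"
    have "bish (N # \<Gamma>) ?\<Delta> (Eq N (plus Zero (Succ \<^bold>\<cdot> Var 0)) (Succ \<^bold>\<cdot> plus Zero (Var 0)))"
      using v by (simp add: plus_Succ)
    also have "bish (N # \<Gamma>) ?\<Delta> (Eq N (Succ \<^bold>\<cdot> plus Zero (Var 0)) (Succ \<^bold>\<cdot> Var 0))"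
      using v by (intro Eq_Succ bish.Assm) simp_all
    finally show "bish (N # \<Gamma>) ?\<Delta> (subf (scons (Succ \<^bold>\<cdot> Var 0) (\<lambda>i. Var (Suc i))) ?\<phi>)"
      by simp
  qed (simp_all add: plus_Zero)
  then show ?thesis by simp
qed

lemma Succ_plus:
  assumes s: "typed \<Gamma> s N" and t: "typed \<Gamma> t N"
  shows "bish \<Gamma> \<Delta> (Eq N (plus (Succ \<^bold>\<cdot> s) t) (Succ \<^bold>\<cdot> plus s t))"
proof -
  let ?\<phi> = "Eq N (plus (Succ \<^bold>\<cdot> lift s) (Var 0)) (Succ \<^bold>\<cdot> plus (lift s) (Var 0))"
  have "bish \<Gamma> \<Delta> (inst ?\<phi> t)"
  proof (rule Induct_inst[OF _ _ _ t])
    have "bish \<Gamma> \<Delta> (Eq N (plus (Succ \<^bold>\<cdot> s) Zero) (Succ \<^bold>\<cdot> s))"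
      using s by (simp add: plus_Zero)
    also have "bish \<Gamma> \<Delta> (Eq N (Succ \<^bold>\<cdot> s) (Succ \<^bold>\<cdot> plus s Zero))"
      by (intro Eq_Succ Eq_sym[OF plus_Zero] s)
    finally show "bish \<Gamma> \<Delta> (inst ?\<phi> Zero)" by simp
  next
    let ?\<Delta> = "?\<phi> # map liftf \<Delta>" and ?s = "lift s"
    have v: "typed (N # \<Gamma>) (Var 0) N" by simp
    have "bish (N # \<Gamma>) ?\<Delta>
        (Eq N (plus (Succ \<^bold>\<cdot> ?s) (Succ \<^bold>\<cdot> Var 0)) (Succ \<^bold>\<cdot> plus (Succ \<^bold>\<cdot> ?s) (Var 0)))"
      using s v by (simp add: plus_Succ)
    also have "bish (N # \<Gamma>) ?\<Delta>
        (Eq N (Succ \<^bold>\<cdot> plus (Succ \<^bold>\<cdot> ?s) (Var 0)) (Succ \<^bold>\<cdot> (Succ \<^bold>\<cdot> plus ?s (Var 0))))"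
      using s v by (intro Eq_Succ bish.Assm) simp_all
    also have "bish (N # \<Gamma>) ?\<Delta>
        (Eq N (Succ \<^bold>\<cdot> (Succ \<^bold>\<cdot> plus ?s (Var 0))) (Succ \<^bold>\<cdot> plus ?s (Succ \<^bold>\<cdot> Var 0)))"
      using s v by (intro Eq_Succ Eq_sym[OF plus_Succ]) simp_all
    finally show "bish (N # \<Gamma>) ?\<Delta> (subf (scons (Succ \<^bold>\<cdot> Var 0) (\<lambda>i. Var (Suc i))) ?\<phi>)"
      by simp
  qed (use s in simp_all)
  then show ?thesis by simp
qed

lemma plus_assoc:
  assumes s: "typed \<Gamma> s N" and t: "typed \<Gamma> t N" and u: "typed \<Gamma> u N"
  shows "bish \<Gamma> \<Delta> (Eq N (plus (plus s t) u) (plus s (plus t u)))"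
proof -
  let ?\<phi> = "Eq N (plus (plus (lift s) (lift t)) (Var 0)) (plus (lift s) (plus (lift t) (Var 0)))"
  have "bish \<Gamma> \<Delta> (inst ?\<phi> u)"
  proof (rule Induct_inst[OF _ _ _ u])
    have "bish \<Gamma> \<Delta> (Eq N (plus (plus s t) Zero) (plus s t))"
      using s t by (simp add: plus_Zero)
    also have "bish \<Gamma> \<Delta> (Eq N (plus s t) (plus s (plus t Zero)))"
      by (intro plus_cong bish.Refl s Eq_sym[OF plus_Zero] t)
    finally show "bish \<Gamma> \<Delta> (inst ?\<phi> Zero)" by simp
  next
    let ?\<Delta> = "?\<phi> # map liftf \<Delta>" and ?s = "lift s" and ?t = "lift t" and ?v = "Var 0"
    have v: "typed (N # \<Gamma>) ?v N" by simp
    have "bish (N # \<Gamma>) ?\<Delta>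
        (Eq N (plus (plus ?s ?t) (Succ \<^bold>\<cdot> ?v)) (Succ \<^bold>\<cdot> plus (plus ?s ?t) ?v))"
      using s t v by (simp add: plus_Succ)
    also have "bish (N # \<Gamma>) ?\<Delta>
        (Eq N (Succ \<^bold>\<cdot> plus (plus ?s ?t) ?v) (Succ \<^bold>\<cdot> plus ?s (plus ?t ?v)))"
      using s t v by (intro Eq_Succ bish.Assm) simp_all
    also have "bish (N # \<Gamma>) ?\<Delta>
        (Eq N (Succ \<^bold>\<cdot> plus ?s (plus ?t ?v)) (plus ?s (Succ \<^bold>\<cdot> plus ?t ?v)))"
      using s t v by (intro Eq_sym[OF plus_Succ]) simp_all
    also have "bish (N # \<Gamma>) ?\<Delta>
        (Eq N (plus ?s (Succ \<^bold>\<cdot> plus ?t ?v)) (plus ?s (plus ?t (Succ \<^bold>\<cdot> ?v))))"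
      using s t v by (intro plus_cong bish.Refl Eq_sym[OF plus_Succ]) simp_all
    finally show "bish (N # \<Gamma>) ?\<Delta> (subf (scons (Succ \<^bold>\<cdot> Var 0) (\<lambda>i. Var (Suc i))) ?\<phi>)"
      by simp
  qed (use s t in simp_all)
  then show ?thesis by simp
qed

lemma leqI:
  assumes "bish \<Gamma> \<Delta> (Eq N (plus s p) t)" "typed \<Gamma> s N" "typed \<Gamma> p N"
  shows "bish \<Gamma> \<Delta> (leq s t)"
  unfolding leq_def using assms Eq_typed[OF assms(1)]
  by (intro bish.ExistsI[where t = p]) simp_all

lemma leqE:
  assumes "bish \<Gamma> \<Delta> (leq s t)" "wf_fm \<Gamma> \<chi>"
    and "bish (N # \<Gamma>) (Eq N (plus (lift s) (Var 0)) (lift t) # map liftf \<Delta>) (liftf \<chi>)"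
  shows "bish \<Gamma> \<Delta> \<chi>"
  using bish.ExistsE[OF assms(1)[unfolded leq_def] assms(2,3)] .

lemma leq_typed:
  assumes "bish \<Gamma> \<Delta> (leq s t)" shows "typed \<Gamma> s N" "typed \<Gamma> t N"
proof -
  \<comment> \<open>Instantiating the bound variable turns the lifted terms back into \<open>s\<close> and \<open>t\<close>.\<close>
  have "wf_fm (N # \<Gamma>) (Eq N (plus (lift s) (Var 0)) (lift t))"
    using bish_wf[OF assms] by (simp add: leq_def)
  then have "wf_fm \<Gamma> (inst (Eq N (plus (lift s) (Var 0)) (lift t)) Zero)"
    by (rule wf_subf) auto
  then show "typed \<Gamma> s N" "typed \<Gamma> t N" by (auto simp: plus_def)
qed

lemma leq_Eq_right:
  assumes st: "bish \<Gamma> \<Delta> (leq s t)" and "bish \<Gamma> \<Delta> (Eq N t t')" shows "bish \<Gamma> \<Delta> (leq s t')"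
  using bish.Replace[of N \<Gamma> "leq (lift s) (Var 0)" \<Delta> t t'] assms leq_typed[OF st] by simp

lemma leq_Eq_left:
  assumes st: "bish \<Gamma> \<Delta> (leq s t)" and "bish \<Gamma> \<Delta> (Eq N s s')" shows "bish \<Gamma> \<Delta> (leq s' t)"
  using bish.Replace[of N \<Gamma> "leq (Var 0) (lift t)" \<Delta> s s'] assms leq_typed[OF st] by simp

lemma Zero_leq: "typed \<Gamma> t N \<Longrightarrow> bish \<Gamma> \<Delta> (leq Zero t)"
  by (rule leqI[OF Zero_plus]) simp_all

lemma lt_Succ: "typed \<Gamma> t N \<Longrightarrow> bish \<Gamma> \<Delta> (lt t (Succ \<^bold>\<cdot> t))"
  unfolding lt_def by (rule leqI[OF plus_Zero]) simp_all

lemma Zero_lt_Succ: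
  assumes t: "typed \<Gamma> t N" shows "bish \<Gamma> \<Delta> (lt Zero (Succ \<^bold>\<cdot> t))"
  unfolding lt_def
proof (rule leqI)
  have "bish \<Gamma> \<Delta> (Eq N (plus (Succ \<^bold>\<cdot> Zero) t) (Succ \<^bold>\<cdot> plus Zero t))"
    using t by (simp add: Succ_plus)
  also have "bish \<Gamma> \<Delta> (Eq N (Succ \<^bold>\<cdot> plus Zero t) (Succ \<^bold>\<cdot> t))"
    by (intro Eq_Succ Zero_plus t)
  finally show "bish \<Gamma> \<Delta> (Eq N (plus (Succ \<^bold>\<cdot> Zero) t) (Succ \<^bold>\<cdot> t))" .
qed (use t in simp_all)

lemma not_lt_Zero:
  assumes "bish \<Gamma> \<Delta> (lt s Zero)" shows "bish \<Gamma> \<Delta> Falsum"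
proof (rule leqE[OF assms[unfolded lt_def]])
  have s: "typed \<Gamma> s N" using leq_typed[OF assms[unfolded lt_def]] by simp
  let ?h = "Eq N (plus (lift (Succ \<^bold>\<cdot> s)) (Var 0)) (lift Zero)"
  have "bish (N # \<Gamma>) (?h # map liftf \<Delta>)
      (Eq N (Succ \<^bold>\<cdot> plus (lift s) (Var 0)) (plus (Succ \<^bold>\<cdot> lift s) (Var 0)))"
    using s by (intro Eq_sym[OF Succ_plus]) simp_all
  also have "bish (N # \<Gamma>) (?h # map liftf \<Delta>) (Eq N (plus (Succ \<^bold>\<cdot> lift s) (Var 0)) Zero)"
    using s by (intro bish.Assm) simp_all
  finally show "bish (N # \<Gamma>) (?h # map liftf \<Delta>) (liftf Falsum)"
    by (auto intro: bish.SuccZero)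
qed simp

text \<open>
  If \<open>s + p = t\<close> and \<open>Succ t + q = u\<close>, then \<open>p + q\<close> witnesses \<open>Succ s \<le> u\<close>.
\<close>

lemma leq_lt_trans:
  assumes st: "bish \<Gamma> \<Delta> (leq s t)" and tu: "bish \<Gamma> \<Delta> (lt t u)"
  shows "bish \<Gamma> \<Delta> (lt s u)"
proof -
  note ty = leq_typed[OF st] leq_typed[OF tu[unfolded lt_def]]
  have "bish \<Gamma> \<Delta> (leq s t \<^bold>\<longrightarrow> lt t u \<^bold>\<longrightarrow> lt s u)"
  proof (intro bish.ImpI)
    let ?\<Delta> = "lt t u # leq s t # \<Delta>"
    have "bish \<Gamma> ?\<Delta> (leq s t)" using ty by (intro bish.Assm) simp_all
    then show "bish \<Gamma> ?\<Delta> (lt s u)"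
    proof (rule leqE)
      let ?\<Gamma> = "N # \<Gamma>" and ?h = "Eq N (plus (lift s) (Var 0)) (lift t)"
      let ?\<Delta>' = "?h # map liftf ?\<Delta>"
      have "bish ?\<Gamma> ?\<Delta>' (leq (Succ \<^bold>\<cdot> lift t) (lift u))"
        using ty by (intro bish.Assm) (simp_all add: lt_def)
      then have "bish ?\<Gamma> ?\<Delta>' (lt (lift s) (lift u))"
      proof (rule leqE)
        let ?\<Gamma>' = "N # N # \<Gamma>" and ?s = "lift (lift s)" and ?t = "lift (lift t)"
          and ?u = "lift (lift u)" and ?p = "Var 1" and ?q = "Var 0"
        let ?h' = "Eq N (plus (lift (Succ \<^bold>\<cdot> lift t)) (Var 0)) (lift (lift u))"
        let ?\<Delta>'' = "?h' # map liftf ?\<Delta>'"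
        have p: "typed ?\<Gamma>' ?p N" and q: "typed ?\<Gamma>' ?q N" by simp_all
        have "bish ?\<Gamma>' ?\<Delta>''
            (Eq N (plus (Succ \<^bold>\<cdot> ?s) (plus ?p ?q)) (plus (plus (Succ \<^bold>\<cdot> ?s) ?p) ?q))"
          using ty p q by (intro Eq_sym[OF plus_assoc]) simp_all
        also have "bish ?\<Gamma>' ?\<Delta>''
            (Eq N (plus (plus (Succ \<^bold>\<cdot> ?s) ?p) ?q) (plus (Succ \<^bold>\<cdot> plus ?s ?p) ?q))"
          using ty p q by (intro plus_cong bish.Refl Succ_plus) simp_all
        also have "bish ?\<Gamma>' ?\<Delta>''
            (Eq N (plus (Succ \<^bold>\<cdot> plus ?s ?p) ?q) (plus (Succ \<^bold>\<cdot> ?t) ?q))"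
          using ty p q by (intro plus_cong bish.Refl Eq_Succ bish.Assm) simp_all
        also have "bish ?\<Gamma>' ?\<Delta>'' (Eq N (plus (Succ \<^bold>\<cdot> ?t) ?q) ?u)"
          using ty p q by (intro bish.Assm) simp_all
        finally have "bish ?\<Gamma>' ?\<Delta>'' (leq (Succ \<^bold>\<cdot> ?s) ?u)"
          using ty p q by (intro leqI[where p = "plus ?p ?q"]) simp_all
        then show "bish ?\<Gamma>' ?\<Delta>'' (liftf (lt (lift s) (lift u)))"
          by (simp add: lt_def)
      qed (use ty in simp_all)
      then show "bish ?\<Gamma> ?\<Delta>' (liftf (lt s u))" by simp
    qed (use ty in simp_all)
  qed (use ty in simp_all)
  from bish.ImpE[OF bish.ImpE[OF this st] tu] show ?thesis .
qed

section \<open>The flag sequence\<close>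

text \<open>
  \<open>flag a 0 = 1\<close>, and \<open>flag a (n + 1)\<close> is \<open>flag a n\<close> if \<open>a n = 0\<close> and \<open>0\<close> otherwise; the inner
  recursor serves as the test of \<open>a n\<close> for zero.  The last argument of the outer recursor is
  left off, so that the recursor equations apply to \<open>flag a\<close> without a preceding \<open>\<beta>\<close>-step.
\<close>

definition flag :: "tm \<Rightarrow> tm" where
  "flag a = Rec N \<^bold>\<cdot> (Succ \<^bold>\<cdot> Zero) \<^bold>\<cdot>
     Lam N (Lam N (Rec N \<^bold>\<cdot> Var 0 \<^bold>\<cdot> Lam N (Lam N Zero) \<^bold>\<cdot> (lift (lift a) \<^bold>\<cdot> Var 1)))"

lemma sub_flag [simp]: "sub \<theta> (flag a) = flag (sub \<theta> a)"
  by (simp add: flag_def)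

lemma ren_flag [simp]: "ren r (flag a) = flag (ren r a)"
  by (simp add: flag_def ren_ren)

lemma typed_LamLam_Zero: "typed \<Gamma> (Lam N (Lam N Zero)) (N \<^bold>\<Rightarrow> N \<^bold>\<Rightarrow> N)"
  by (intro typed.intros)

lemma typed_flag_body:
  "typed \<Gamma> a (N \<^bold>\<Rightarrow> N) \<Longrightarrow>
   typed (N # N # \<Gamma>) (Rec N \<^bold>\<cdot> Var 0 \<^bold>\<cdot> Lam N (Lam N Zero) \<^bold>\<cdot> (lift (lift a) \<^bold>\<cdot> Var 1)) N"
  by (intro typed.App[OF typed.App[OF typed.App[OF typed.Rec]]] typed_LamLam_Zero) simp_all

lemma typed_flag [simp]: "typed \<Gamma> a (N \<^bold>\<Rightarrow> N) \<Longrightarrow> typed \<Gamma> (flag a) (N \<^bold>\<Rightarrow> N)"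
  unfolding flag_def
  by (intro typed.App[OF typed.App[OF typed.Rec]] typed.Lam typed_flag_body) simp_all

lemma flag_Zero: "typed \<Gamma> a (N \<^bold>\<Rightarrow> N) \<Longrightarrow> bish \<Gamma> \<Delta> (Eq N (flag a \<^bold>\<cdot> Zero) (Succ \<^bold>\<cdot> Zero))"
  unfolding flag_def by (intro bish.RecZero typed.Lam typed_flag_body) simp_all

lemma flag_Succ:
  assumes a: "typed \<Gamma> a (N \<^bold>\<Rightarrow> N)" and n: "typed \<Gamma> n N"
  shows "bish \<Gamma> \<Delta> (Eq N (flag a \<^bold>\<cdot> (Succ \<^bold>\<cdot> n))
    (Rec N \<^bold>\<cdot> (flag a \<^bold>\<cdot> n) \<^bold>\<cdot> Lam N (Lam N Zero) \<^bold>\<cdot> (a \<^bold>\<cdot> n)))"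
proof -
  let ?b = "Rec N \<^bold>\<cdot> Var 0 \<^bold>\<cdot> Lam N (Lam N Zero) \<^bold>\<cdot> (lift (lift a) \<^bold>\<cdot> Var 1)"
  have "bish \<Gamma> \<Delta> (Eq N (flag a \<^bold>\<cdot> (Succ \<^bold>\<cdot> n)) (Lam N (Lam N ?b) \<^bold>\<cdot> n \<^bold>\<cdot> (flag a \<^bold>\<cdot> n)))"
    unfolding flag_def using a n by (intro bish.RecSucc typed.Lam typed_flag_body) simp_all
  also have "bish \<Gamma> \<Delta> (Eq N (Lam N (Lam N ?b) \<^bold>\<cdot> n \<^bold>\<cdot> (flag a \<^bold>\<cdot> n))
      (Rec N \<^bold>\<cdot> (flag a \<^bold>\<cdot> n) \<^bold>\<cdot> Lam N (Lam N Zero) \<^bold>\<cdot> (a \<^bold>\<cdot> n)))"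
    using Beta2[OF typed_flag_body[OF a] n, of "flag a \<^bold>\<cdot> n" \<Delta>] a n by simp
  finally show ?thesis .
qed

lemma flag_keep:
  assumes a: "typed \<Gamma> a (N \<^bold>\<Rightarrow> N)" and an: "bish \<Gamma> \<Delta> (Eq N (a \<^bold>\<cdot> n) Zero)"
    and n: "typed \<Gamma> n N"
  shows "bish \<Gamma> \<Delta> (Eq N (flag a \<^bold>\<cdot> (Succ \<^bold>\<cdot> n)) (flag a \<^bold>\<cdot> n))"
proof -
  let ?r = "Rec N \<^bold>\<cdot> (flag a \<^bold>\<cdot> n) \<^bold>\<cdot> Lam N (Lam N Zero)"
  have r: "typed \<Gamma> ?r (N \<^bold>\<Rightarrow> N)"
    using a n by (intro typed.App[OF typed.App[OF typed.Rec]] typed_LamLam_Zero) simp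
  have "bish \<Gamma> \<Delta> (Eq N (flag a \<^bold>\<cdot> (Succ \<^bold>\<cdot> n)) (?r \<^bold>\<cdot> (a \<^bold>\<cdot> n)))"
    using a n by (rule flag_Succ)
  also have "bish \<Gamma> \<Delta> (Eq N (?r \<^bold>\<cdot> (a \<^bold>\<cdot> n)) (?r \<^bold>\<cdot> Zero))"
    using r an by (rule Eq_arg)
  also have "bish \<Gamma> \<Delta> (Eq N (?r \<^bold>\<cdot> Zero) (flag a \<^bold>\<cdot> n))"
    using a n by (intro bish.RecZero typed_LamLam_Zero) simp
  finally show ?thesis .
qed

lemma flag_drop:
  assumes a: "typed \<Gamma> a (N \<^bold>\<Rightarrow> N)" and an: "bish \<Gamma> \<Delta> (Eq N (a \<^bold>\<cdot> n) (Succ \<^bold>\<cdot> Zero))"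
    and n: "typed \<Gamma> n N"
  shows "bish \<Gamma> \<Delta> (Eq N (flag a \<^bold>\<cdot> (Succ \<^bold>\<cdot> n)) Zero)"
proof -
  let ?k = "Lam N (Lam N Zero)"
  let ?r = "Rec N \<^bold>\<cdot> (flag a \<^bold>\<cdot> n) \<^bold>\<cdot> ?k"
  have r: "typed \<Gamma> ?r (N \<^bold>\<Rightarrow> N)"
    using a n by (intro typed.App[OF typed.App[OF typed.Rec]] typed_LamLam_Zero) simp
  have "bish \<Gamma> \<Delta> (Eq N (flag a \<^bold>\<cdot> (Succ \<^bold>\<cdot> n)) (?r \<^bold>\<cdot> (a \<^bold>\<cdot> n)))"
    using a n by (rule flag_Succ)
  also have "bish \<Gamma> \<Delta> (Eq N (?r \<^bold>\<cdot> (a \<^bold>\<cdot> n)) (?r \<^bold>\<cdot> (Succ \<^bold>\<cdot> Zero)))"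
    using r an by (rule Eq_arg)
  also have "bish \<Gamma> \<Delta> (Eq N (?r \<^bold>\<cdot> (Succ \<^bold>\<cdot> Zero)) (?k \<^bold>\<cdot> Zero \<^bold>\<cdot> (?r \<^bold>\<cdot> Zero)))"
    using a n by (intro bish.RecSucc typed_LamLam_Zero) simp_all
  also have "bish \<Gamma> \<Delta> (Eq N (?k \<^bold>\<cdot> Zero \<^bold>\<cdot> (?r \<^bold>\<cdot> Zero)) Zero)"
    using Beta2[of N N \<Gamma> Zero N Zero "?r \<^bold>\<cdot> Zero" \<Delta>] r by simp
  finally show ?thesis .
qed

section \<open>Binary sequences\<close>

definition binary :: "tm \<Rightarrow> fm" where
  "binary a = Forall N (Eq N (lift a \<^bold>\<cdot> Var 0) Zero \<^bold>\<or> Eq N (lift a \<^bold>\<cdot> Var 0) (Succ \<^bold>\<cdot> Zero))"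

definition has_one :: "tm \<Rightarrow> fm" where
  "has_one a = Exists N (Eq N (lift a \<^bold>\<cdot> Var 0) (Succ \<^bold>\<cdot> Zero))"

definition all_zero :: "tm \<Rightarrow> fm" where
  "all_zero a = Forall N (Eq N (lift a \<^bold>\<cdot> Var 0) Zero)"

lemma subf_binary [simp]: "subf \<theta> (binary a) = binary (sub \<theta> a)"
  by (simp add: binary_def)

lemma subf_has_one [simp]: "subf \<theta> (has_one a) = has_one (sub \<theta> a)"
  by (simp add: has_one_def)

lemma subf_all_zero [simp]: "subf \<theta> (all_zero a) = all_zero (sub \<theta> a)"
  by (simp add: all_zero_def)

lemma wf_binary [simp]: "typed \<Gamma> a (N \<^bold>\<Rightarrow> N) \<Longrightarrow> wf_fm \<Gamma> (binary a)"
  by (simp add: binary_def)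

lemma wf_has_one [simp]: "typed \<Gamma> a (N \<^bold>\<Rightarrow> N) \<Longrightarrow> wf_fm \<Gamma> (has_one a)"
  by (simp add: has_one_def)

lemma wf_all_zero [simp]: "typed \<Gamma> a (N \<^bold>\<Rightarrow> N) \<Longrightarrow> wf_fm \<Gamma> (all_zero a)"
  by (simp add: all_zero_def)

text \<open>
  This is the only decision about \<open>a\<close> that the argument makes; a single value can be examined
  intuitionistically.
\<close>

lemma binary_cases:
  assumes "binary a \<in> set \<Delta>" "typed \<Gamma> a (N \<^bold>\<Rightarrow> N)" "typed \<Gamma> n N"
    and "bish \<Gamma> (Eq N (a \<^bold>\<cdot> n) Zero # \<Delta>) \<chi>" "bish \<Gamma> (Eq N (a \<^bold>\<cdot> n) (Succ \<^bold>\<cdot> Zero) # \<Delta>) \<chi>"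
  shows "bish \<Gamma> \<Delta> \<chi>"
proof -
  have "bish \<Gamma> \<Delta> (binary a)" using assms by (intro bish.Assm) simp_all
  from bish.ForallE[OF this[unfolded binary_def] assms(3)]
  show ?thesis using assms(4,5) by (auto intro: bish.DisjE)
qed

lemma has_oneI:
  "bish \<Gamma> \<Delta> (Eq N (a \<^bold>\<cdot> n) (Succ \<^bold>\<cdot> Zero)) \<Longrightarrow> typed \<Gamma> a (N \<^bold>\<Rightarrow> N) \<Longrightarrow> typed \<Gamma> n N \<Longrightarrow>
   bish \<Gamma> \<Delta> (has_one a)"
  unfolding has_one_def by (rule bish.ExistsI) simp_all

text \<open>
  Induction on \<open>n\<close>: the flag can only change from \<open>1\<close> at a step \<open>n\<close> with \<open>a n = 1\<close>, and then
  \<open>n\<close> is the required witness.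
\<close>

lemma has_one_or_flag:
  assumes bin: "binary a \<in> set \<Delta>" and a: "typed \<Gamma> a (N \<^bold>\<Rightarrow> N)" and n: "typed \<Gamma> n N"
  shows "bish \<Gamma> \<Delta> (has_one a \<^bold>\<or> Eq N (flag a \<^bold>\<cdot> n) (Succ \<^bold>\<cdot> Zero))"
proof -
  let ?e = "Eq N (flag (lift a) \<^bold>\<cdot> Var 0) (Succ \<^bold>\<cdot> Zero)"
  let ?\<phi> = "has_one (lift a) \<^bold>\<or> ?e"
  have "bish \<Gamma> \<Delta> (inst ?\<phi> n)"
  proof (rule Induct_inst[OF _ _ _ n])
    show "bish \<Gamma> \<Delta> (inst ?\<phi> Zero)" using a by (simp add: bish.DisjI2 flag_Zero)
  next
    let ?\<Gamma> = "N # \<Gamma>" and ?\<Delta> = "?\<phi> # map liftf \<Delta>" and ?a = "lift a" and ?v = "Var 0"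
    let ?g = "has_one ?a \<^bold>\<or> Eq N (flag ?a \<^bold>\<cdot> (Succ \<^bold>\<cdot> ?v)) (Succ \<^bold>\<cdot> Zero)"
    have bin': "binary ?a \<in> set (map liftf \<Delta>)"
      using imageI[OF bin, of liftf] by simp
    have "bish ?\<Gamma> ?\<Delta> ?\<phi>" using a by (intro bish.Assm) simp_all
    then have "bish ?\<Gamma> ?\<Delta> ?g"
    proof (rule bish.DisjE)
      show "bish ?\<Gamma> (has_one ?a # ?\<Delta>) ?g"
        using a by (intro bish.DisjI1 bish.Assm) simp_all
    next
      show "bish ?\<Gamma> (?e # ?\<Delta>) ?g"
      proof (rule binary_cases[of ?a _ _ ?v])
        let ?z = "Eq N (?a \<^bold>\<cdot> ?v) Zero" and ?o = "Eq N (?a \<^bold>\<cdot> ?v) (Succ \<^bold>\<cdot> Zero)"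
        have "bish ?\<Gamma> (?z # ?e # ?\<Delta>) (Eq N (flag ?a \<^bold>\<cdot> (Succ \<^bold>\<cdot> ?v)) (flag ?a \<^bold>\<cdot> ?v))"
          using a by (intro flag_keep bish.Assm) simp_all
        also have "bish ?\<Gamma> (?z # ?e # ?\<Delta>) (Eq N (flag ?a \<^bold>\<cdot> ?v) (Succ \<^bold>\<cdot> Zero))"
          using a by (intro bish.Assm) simp_all
        finally show "bish ?\<Gamma> (?z # ?e # ?\<Delta>) ?g" using a by (intro bish.DisjI2) simp_all
        have "bish ?\<Gamma> (?o # ?e # ?\<Delta>) (has_one ?a)"
          using a by (intro has_oneI[of _ _ _ ?v] bish.Assm) simp_all
        then show "bish ?\<Gamma> (?o # ?e # ?\<Delta>) ?g" using a by (intro bish.DisjI1) simp_all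
      qed (use a bin' in simp_all)
    qed
    then show "bish ?\<Gamma> ?\<Delta> (subf (scons (Succ \<^bold>\<cdot> Var 0) (\<lambda>i. Var (Suc i))) ?\<phi>)" by simp
  qed (use a in simp_all)
  then show ?thesis by simp
qed

text \<open>
  Either case of the recursion for \<open>flag a\<close> keeps a value \<open>0\<close>.
\<close>

lemma flag_plus_vanishes:
  assumes bin: "binary a \<in> set \<Delta>" and zero: "Eq N (flag a \<^bold>\<cdot> n) Zero \<in> set \<Delta>"
    and a: "typed \<Gamma> a (N \<^bold>\<Rightarrow> N)" and n: "typed \<Gamma> n N" and p: "typed \<Gamma> p N"
  shows "bish \<Gamma> \<Delta> (Eq N (flag a \<^bold>\<cdot> plus n p) Zero)"
proof -
  let ?\<phi> = "Eq N (flag (lift a) \<^bold>\<cdot> plus (lift n) (Var 0)) Zero"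
  have "bish \<Gamma> \<Delta> (inst ?\<phi> p)"
  proof (rule Induct_inst[OF _ _ _ p])
    have "bish \<Gamma> \<Delta> (Eq N (flag a \<^bold>\<cdot> plus n Zero) (flag a \<^bold>\<cdot> n))"
      using a n by (intro Eq_arg[where \<sigma> = N] plus_Zero) simp_all
    also have "bish \<Gamma> \<Delta> (Eq N (flag a \<^bold>\<cdot> n) Zero)"
      using a n zero by (intro bish.Assm) simp_all
    finally show "bish \<Gamma> \<Delta> (inst ?\<phi> Zero)" by simp
  next
    let ?\<Gamma> = "N # \<Gamma>" and ?\<Delta> = "?\<phi> # map liftf \<Delta>" and ?a = "lift a"
    let ?m = "plus (lift n) (Var 0)"
    have bin': "binary ?a \<in> set (map liftf \<Delta>)"
      using imageI[OF bin, of liftf] by simp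
    have m: "typed ?\<Gamma> ?m N" using n by simp
    have "bish ?\<Gamma> ?\<Delta>
        (Eq N (flag ?a \<^bold>\<cdot> plus (lift n) (Succ \<^bold>\<cdot> Var 0)) (flag ?a \<^bold>\<cdot> (Succ \<^bold>\<cdot> ?m)))"
      using a n by (intro Eq_arg[where \<sigma> = N] plus_Succ) simp_all
    also have "bish ?\<Gamma> ?\<Delta> (Eq N (flag ?a \<^bold>\<cdot> (Succ \<^bold>\<cdot> ?m)) Zero)"
    proof (rule binary_cases[of ?a _ _ ?m])
      let ?z = "Eq N (?a \<^bold>\<cdot> ?m) Zero" and ?o = "Eq N (?a \<^bold>\<cdot> ?m) (Succ \<^bold>\<cdot> Zero)"
      have "bish ?\<Gamma> (?z # ?\<Delta>) (Eq N (flag ?a \<^bold>\<cdot> (Succ \<^bold>\<cdot> ?m)) (flag ?a \<^bold>\<cdot> ?m))"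
        using a m by (intro flag_keep bish.Assm) simp_all
      also have "bish ?\<Gamma> (?z # ?\<Delta>) (Eq N (flag ?a \<^bold>\<cdot> ?m) Zero)"
        using a m by (intro bish.Assm) simp_all
      finally show "bish ?\<Gamma> (?z # ?\<Delta>) (Eq N (flag ?a \<^bold>\<cdot> (Succ \<^bold>\<cdot> ?m)) Zero)" .
      show "bish ?\<Gamma> (?o # ?\<Delta>) (Eq N (flag ?a \<^bold>\<cdot> (Succ \<^bold>\<cdot> ?m)) Zero)"
        using a m by (intro flag_drop bish.Assm) simp_all
    qed (use a m bin' in simp_all)
    finally show "bish ?\<Gamma> ?\<Delta> (subf (scons (Succ \<^bold>\<cdot> Var 0) (\<lambda>i. Var (Suc i))) ?\<phi>)" by simp
  qed (use a n in simp_all)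
  then show ?thesis by simp
qed

lemma flag_vanishes_above:
  assumes bin: "binary a \<in> set \<Delta>" and a: "typed \<Gamma> a (N \<^bold>\<Rightarrow> N)"
    and zero: "bish \<Gamma> \<Delta> (Eq N (flag a \<^bold>\<cdot> n) Zero)" and le: "bish \<Gamma> \<Delta> (leq n x)"
  shows "bish \<Gamma> \<Delta> (Eq N (flag a \<^bold>\<cdot> x) Zero)"
proof -
  note ty = a leq_typed[OF le]
  let ?z = "Eq N (flag a \<^bold>\<cdot> n) Zero" and ?g = "Eq N (flag a \<^bold>\<cdot> x) Zero"
  have "bish \<Gamma> \<Delta> (?z \<^bold>\<longrightarrow> leq n x \<^bold>\<longrightarrow> ?g)"
  proof (intro bish.ImpI)
    let ?\<Delta> = "leq n x # ?z # \<Delta>"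
    have "bish \<Gamma> ?\<Delta> (leq n x)" using ty by (intro bish.Assm) simp_all
    then show "bish \<Gamma> ?\<Delta> ?g"
    proof (rule leqE)
      let ?\<Gamma> = "N # \<Gamma>" and ?a = "lift a" and ?m = "plus (lift n) (Var 0)"
      let ?\<Delta>' = "Eq N ?m (lift x) # map liftf ?\<Delta>"
      have "bish ?\<Gamma> ?\<Delta>' (Eq N (flag ?a \<^bold>\<cdot> lift x) (flag ?a \<^bold>\<cdot> ?m))"
        using ty by (intro Eq_arg[where \<sigma> = N] Eq_sym[OF bish.Assm]) simp_all
      also have "bish ?\<Gamma> ?\<Delta>' (Eq N (flag ?a \<^bold>\<cdot> ?m) Zero)"
        using ty imageI[OF bin, of liftf] by (intro flag_plus_vanishes) simp_all
      finally show "bish ?\<Gamma> ?\<Delta>' (liftf ?g)" by simp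
    qed (use ty in simp_all)
  qed (use ty in simp_all)
  from bish.ImpE[OF bish.ImpE[OF this zero] le] show ?thesis .
qed

section \<open>Monotone subsequences\<close>

definition increasing :: "tm \<Rightarrow> fm" where
  "increasing f = Forall N (Forall N (lt (Var 1) (Var 0) \<^bold>\<longrightarrow>
     lt (lift (lift f) \<^bold>\<cdot> Var 1) (lift (lift f) \<^bold>\<cdot> Var 0)))"

definition nondecreasing_along :: "tm \<Rightarrow> tm \<Rightarrow> fm" where
  "nondecreasing_along b f = Forall N (Forall N
     (lt (lift (lift f) \<^bold>\<cdot> Var 1) (lift (lift f) \<^bold>\<cdot> Var 0) \<^bold>\<longrightarrow>
      leq (lift (lift b) \<^bold>\<cdot> (lift (lift f) \<^bold>\<cdot> Var 1)) (lift (lift b) \<^bold>\<cdot> (lift (lift f) \<^bold>\<cdot> Var 0))))"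

lemma subf_increasing [simp]: "subf \<theta> (increasing f) = increasing (sub \<theta> f)"
  by (simp add: increasing_def)

lemma subf_nondecreasing_along [simp]:
  "subf \<theta> (nondecreasing_along b f) = nondecreasing_along (sub \<theta> b) (sub \<theta> f)"
  by (simp add: nondecreasing_along_def)

lemma wf_increasing [simp]: "typed \<Gamma> f (N \<^bold>\<Rightarrow> N) \<Longrightarrow> wf_fm \<Gamma> (increasing f)"
  by (simp add: increasing_def)

lemma wf_nondecreasing_along [simp]:
  "typed \<Gamma> b (N \<^bold>\<Rightarrow> N) \<Longrightarrow> typed \<Gamma> f (N \<^bold>\<Rightarrow> N) \<Longrightarrow> wf_fm \<Gamma> (nondecreasing_along b f)"
  by (simp add: nondecreasing_along_def)

lemma Forall2E:
  assumes "bish \<Gamma> \<Delta> (Forall \<sigma> (Forall \<tau> \<phi>))" "typed \<Gamma> s \<sigma>" "typed \<Gamma> t \<tau>"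
  shows "bish \<Gamma> \<Delta> (inst (subf (ups (scons s Var)) \<phi>) t)"
  using bish.ForallE[OF assms(1,2)] assms(3) by (simp add: bish.ForallE)

lemma increasingD:
  assumes "increasing f \<in> set \<Delta>" "typed \<Gamma> f (N \<^bold>\<Rightarrow> N)" and lt: "bish \<Gamma> \<Delta> (lt m n)"
  shows "bish \<Gamma> \<Delta> (lt (f \<^bold>\<cdot> m) (f \<^bold>\<cdot> n))"
proof -
  have "bish \<Gamma> \<Delta> (increasing f)" using assms by (intro bish.Assm) simp_all
  from Forall2E[OF this[unfolded increasing_def], of m n] leq_typed[OF lt[unfolded lt_def]]
  have "bish \<Gamma> \<Delta> (lt m n \<^bold>\<longrightarrow> lt (f \<^bold>\<cdot> m) (f \<^bold>\<cdot> n))" by simp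
  from this lt show ?thesis by (rule bish.ImpE)
qed

lemma nondecreasing_alongD:
  assumes "nondecreasing_along b f \<in> set \<Delta>" "typed \<Gamma> b (N \<^bold>\<Rightarrow> N)" "typed \<Gamma> f (N \<^bold>\<Rightarrow> N)"
    and lt: "bish \<Gamma> \<Delta> (lt (f \<^bold>\<cdot> m) (f \<^bold>\<cdot> n))" and "typed \<Gamma> m N" "typed \<Gamma> n N"
  shows "bish \<Gamma> \<Delta> (leq (b \<^bold>\<cdot> (f \<^bold>\<cdot> m)) (b \<^bold>\<cdot> (f \<^bold>\<cdot> n)))"
proof -
  have "bish \<Gamma> \<Delta> (nondecreasing_along b f)" using assms by (intro bish.Assm) simp_all
  from Forall2E[OF this[unfolded nondecreasing_along_def], of m n] assms
  have "bish \<Gamma> \<Delta> (lt (f \<^bold>\<cdot> m) (f \<^bold>\<cdot> n) \<^bold>\<longrightarrow> leq (b \<^bold>\<cdot> (f \<^bold>\<cdot> m)) (b \<^bold>\<cdot> (f \<^bold>\<cdot> n)))" by simp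
  from this lt show ?thesis by (rule bish.ImpE)
qed

text \<open>
  Induction: \<open>n \<le> f n < f (n + 1)\<close> gives \<open>n < f (n + 1)\<close>, which unfolds to
  \<open>n + 1 \<le> f (n + 1)\<close>.
\<close>

lemma increasing_above_id:
  assumes inc: "increasing f \<in> set \<Delta>" and f: "typed \<Gamma> f (N \<^bold>\<Rightarrow> N)" and n: "typed \<Gamma> n N"
  shows "bish \<Gamma> \<Delta> (leq n (f \<^bold>\<cdot> n))"
proof -
  let ?\<phi> = "leq (Var 0) (lift f \<^bold>\<cdot> Var 0)"
  have "bish \<Gamma> \<Delta> (inst ?\<phi> n)"
  proof (rule Induct_inst[OF _ _ _ n])
    show "bish \<Gamma> \<Delta> (inst ?\<phi> Zero)" using f by (simp add: Zero_leq)
  next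
    let ?\<Gamma> = "N # \<Gamma>" and ?\<Delta> = "?\<phi> # map liftf \<Delta>" and ?f = "lift f" and ?v = "Var 0"
    have "bish ?\<Gamma> ?\<Delta> (leq ?v (?f \<^bold>\<cdot> ?v))" using f by (intro bish.Assm) simp_all
    moreover have "bish ?\<Gamma> ?\<Delta> (lt (?f \<^bold>\<cdot> ?v) (?f \<^bold>\<cdot> (Succ \<^bold>\<cdot> ?v)))"
      using f imageI[OF inc, of liftf] by (intro increasingD lt_Succ) simp_all
    ultimately have "bish ?\<Gamma> ?\<Delta> (lt ?v (?f \<^bold>\<cdot> (Succ \<^bold>\<cdot> ?v)))" by (rule leq_lt_trans)
    then show "bish ?\<Gamma> ?\<Delta> (subf (scons (Succ \<^bold>\<cdot> Var 0) (\<lambda>i. Var (Suc i))) ?\<phi>)"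
      by (simp add: lt_def)
  qed (use f in simp_all)
  then show ?thesis by simp
qed

text \<open>
  The flag is \<open>0\<close> from \<open>n + 1\<close> on, hence at \<open>f (n + 1)\<close>, yet it should be at least its value
  \<open>1\<close> at \<open>f 0\<close>.  The index \<open>n + 1\<close> rather than \<open>n\<close> is used because the flag reacts to \<open>a n\<close> one
  step later, and because it makes the index differ from \<open>0\<close>.
\<close>

lemma one_contradicts_flag:
  assumes bin: "binary a \<in> set \<Delta>" and inc: "increasing f \<in> set \<Delta>"
    and nd: "nondecreasing_along (flag a) f \<in> set \<Delta>"
    and start: "Eq N (flag a \<^bold>\<cdot> (f \<^bold>\<cdot> Zero)) (Succ \<^bold>\<cdot> Zero) \<in> set \<Delta>"
    and one: "Eq N (a \<^bold>\<cdot> n) (Succ \<^bold>\<cdot> Zero) \<in> set \<Delta>"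
    and a: "typed \<Gamma> a (N \<^bold>\<Rightarrow> N)" and f: "typed \<Gamma> f (N \<^bold>\<Rightarrow> N)" and n: "typed \<Gamma> n N"
  shows "bish \<Gamma> \<Delta> Falsum"
proof -
  let ?k = "Succ \<^bold>\<cdot> n"
  have k: "typed \<Gamma> ?k N" using n by simp
  have "bish \<Gamma> \<Delta> (Eq N (flag a \<^bold>\<cdot> ?k) Zero)"
    using a n one by (intro flag_drop bish.Assm) simp_all
  from flag_vanishes_above[OF bin a this increasing_above_id[OF inc f k]]
  have zero: "bish \<Gamma> \<Delta> (Eq N (flag a \<^bold>\<cdot> (f \<^bold>\<cdot> ?k)) Zero)" .
  have "bish \<Gamma> \<Delta> (lt (f \<^bold>\<cdot> Zero) (f \<^bold>\<cdot> ?k))"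
    by (intro increasingD inc f Zero_lt_Succ n)
  then have "bish \<Gamma> \<Delta> (leq (flag a \<^bold>\<cdot> (f \<^bold>\<cdot> Zero)) (flag a \<^bold>\<cdot> (f \<^bold>\<cdot> ?k)))"
    using a f k by (intro nondecreasing_alongD nd) simp_all
  from leq_Eq_right[OF this zero]
  have "bish \<Gamma> \<Delta> (leq (flag a \<^bold>\<cdot> (f \<^bold>\<cdot> Zero)) Zero)" .
  moreover have "bish \<Gamma> \<Delta> (Eq N (flag a \<^bold>\<cdot> (f \<^bold>\<cdot> Zero)) (Succ \<^bold>\<cdot> Zero))"
    using a f start by (intro bish.Assm) simp_all
  ultimately have "bish \<Gamma> \<Delta> (lt Zero Zero)"
    unfolding lt_def by (rule leq_Eq_left)
  then show ?thesis by (rule not_lt_Zero)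
qed

text \<open>
  \<open>has_one_or_flag\<close> at the first index \<open>f 0\<close> of the subsequence is the decision asked for by
  \<open>LPO\<close>: its second alternative excludes every \<open>1\<close>.
\<close>

lemma decide_along_subsequence:
  assumes bin: "binary a \<in> set \<Delta>" and inc: "increasing f \<in> set \<Delta>"
    and nd: "nondecreasing_along (flag a) f \<in> set \<Delta>"
    and a: "typed \<Gamma> a (N \<^bold>\<Rightarrow> N)" and f: "typed \<Gamma> f (N \<^bold>\<Rightarrow> N)"
  shows "bish \<Gamma> \<Delta> (has_one a \<^bold>\<or> all_zero a)"
proof (rule bish.DisjE)
  let ?start = "Eq N (flag a \<^bold>\<cdot> (f \<^bold>\<cdot> Zero)) (Succ \<^bold>\<cdot> Zero)"
  show "bish \<Gamma> \<Delta> (has_one a \<^bold>\<or> ?start)"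
    using bin a f by (intro has_one_or_flag) simp_all
  show "bish \<Gamma> (has_one a # \<Delta>) (has_one a \<^bold>\<or> all_zero a)"
    using a by (intro bish.DisjI1 bish.Assm) simp_all
  have "bish \<Gamma> (?start # \<Delta>) (all_zero a)"
    unfolding all_zero_def
  proof (rule bish.ForallI)
    let ?\<Gamma> = "N # \<Gamma>" and ?\<Delta> = "map liftf (?start # \<Delta>)" and ?a = "lift a" and ?n = "Var 0"
    have mem: "binary ?a \<in> set ?\<Delta>" "increasing (lift f) \<in> set ?\<Delta>"
        "nondecreasing_along (flag ?a) (lift f) \<in> set ?\<Delta>"
      using imageI[OF bin, of liftf] imageI[OF inc, of liftf] imageI[OF nd, of liftf] by simp_all
    show "bish ?\<Gamma> ?\<Delta> (Eq N (?a \<^bold>\<cdot> ?n) Zero)"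
    proof (rule binary_cases[of ?a _ _ ?n])
      show "bish ?\<Gamma> (Eq N (?a \<^bold>\<cdot> ?n) Zero # ?\<Delta>) (Eq N (?a \<^bold>\<cdot> ?n) Zero)"
        using a by (intro bish.Assm) simp_all
      have "bish ?\<Gamma> (Eq N (?a \<^bold>\<cdot> ?n) (Succ \<^bold>\<cdot> Zero) # ?\<Delta>) Falsum"
        using a f mem by (intro one_contradicts_flag[of ?a _ "lift f" ?n]) simp_all
      then show "bish ?\<Gamma> (Eq N (?a \<^bold>\<cdot> ?n) (Succ \<^bold>\<cdot> Zero) # ?\<Delta>) (Eq N (?a \<^bold>\<cdot> ?n) Zero)"
        by (rule bish.FalsumE) (use a in simp_all)
    qed (use a mem in simp_all)
  qed
  then show "bish \<Gamma> (?start # \<Delta>) (has_one a \<^bold>\<or> all_zero a)"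
    using a by (intro bish.DisjI2) simp_all
qed

section \<open>The implication\<close>

lemma DL_1_inf_alt:
  "DL_1_inf = Forall (N \<^bold>\<Rightarrow> N) (Exists (N \<^bold>\<Rightarrow> N)
     (increasing (Var 0) \<^bold>\<and> nondecreasing_along (Var 1) (Var 0)))"
  by (simp add: DL_1_inf_def increasing_def nondecreasing_along_def eval_nat_numeral)

lemma LPO_alt:
  "LPO = Forall (N \<^bold>\<Rightarrow> N) (binary (Var 0) \<^bold>\<longrightarrow> has_one (Var 0) \<^bold>\<or> all_zero (Var 0))"
  by (simp add: LPO_def binary_def has_one_def all_zero_def)

theorem proposition4p2: "bish [] [] (DL_1_inf \<^bold>\<longrightarrow> LPO)"
  unfolding LPO_alt
proof (intro bish.ImpI bish.ForallI)
  show "wf_fm [] DL_1_inf" by (simp add: DL_1_inf_alt)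
  let ?a = "Var 0" and ?\<Gamma> = "[N \<^bold>\<Rightarrow> N]"
  let ?\<Delta> = "binary ?a # map liftf [DL_1_inf]"
  let ?\<psi> = "increasing (Var 0) \<^bold>\<and> nondecreasing_along (flag (Var 1)) (Var 0)"
  show "wf_fm ?\<Gamma> (binary ?a)" by simp
  have "bish ?\<Gamma> ?\<Delta> DL_1_inf"
    by (intro bish.Assm) (simp_all add: DL_1_inf_alt)
  from bish.ForallE[OF this[unfolded DL_1_inf_alt], of "flag ?a"]
  have "bish ?\<Gamma> ?\<Delta> (Exists (N \<^bold>\<Rightarrow> N) ?\<psi>)" by (simp add: DL_1_inf_alt)
  then show "bish ?\<Gamma> ?\<Delta> (has_one ?a \<^bold>\<or> all_zero ?a)"
  proof (rule bish.ExistsE)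
    let ?\<Gamma>' = "(N \<^bold>\<Rightarrow> N) # ?\<Gamma>" and ?\<Delta>' = "?\<psi> # map liftf ?\<Delta>"
    let ?i = "increasing (Var 0)" and ?d = "nondecreasing_along (flag (Var 1)) (Var 0)"
    let ?g = "has_one (Var 1) \<^bold>\<or> all_zero (Var 1)"
    have \<psi>: "bish ?\<Gamma>' ?\<Delta>' ?\<psi>" by (intro bish.Assm) simp_all
    have "bish ?\<Gamma>' ?\<Delta>' (?i \<^bold>\<longrightarrow> ?d \<^bold>\<longrightarrow> ?g)"
      by (intro bish.ImpI decide_along_subsequence[of _ _ "Var 0"]) simp_all
    from bish.ImpE[OF bish.ImpE[OF this bish.ConjE1[OF \<psi>]] bish.ConjE2[OF \<psi>]]
    show "bish ?\<Gamma>' ?\<Delta>' (liftf (has_one ?a \<^bold>\<or> all_zero ?a))" by simp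
  qed simp_all
qed

end
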